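(* Let $k\ge1$ be an integer. For any finite set $X\subseteq[0,1]^k$ of even size, there exists a perfect matching $M$ on $X$ such that $S_k(M)\le 2(k+1)\cdot k^{k/2}$. In other words, $S_k^{\mathrm{PM}}\le 2(k+1)\cdot k^{k/2}$.
   Context: For an edge $e=\mathbf{a}\mathbf{b}$ with $\mathbf{a},\mathbf{b}\in\mathbb{R}^k$, $|e|:=|\mathbf{a}-\mathbf{b}|$ is the Euclidean distance between its endpoints. A perfect matching on a finite set $X$ is a perfect matching in the complete graph on vertex set $X$. $S_k(M):=\sum_{e\in M}|e|^k$. Set $S_k^{\mathrm{PM}}(X):=\min_M S_k(M)$ over all perfect matchings $M$ on $X$, and let $S_k^{\mathrm{PM}}$ be the supremum of $S_k^{\mathrm{PM}}(X)$ over all finite sets $X\subseteq[0,1]^k$ of even size. *)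

theory Defs
  imports "HOL-Analysis.Analysis"
begin

definition complete_graph_edges :: "'a set \<Rightarrow> 'a set set" where
  "complete_graph_edges X = {{a, b} | a b. a \<in> X \<and> b \<in> X \<and> a \<noteq> b}"

definition perfect_matching :: "'a set \<Rightarrow> 'a set set \<Rightarrow> bool" where
  "perfect_matching X M \<longleftrightarrow>
     M \<subseteq> complete_graph_edges X \<and> (\<forall>x\<in>X. \<exists>!e. e \<in> M \<and> x \<in> e)"

text \<open>Edges are unordered pairs, so the length is extracted by a definite description;
  it is unspecified for sets that are not of the form \<open>{a, b}\<close>.\<close>

definition edge_length :: "'a::real_normed_vector set \<Rightarrow> real" where
  "edge_length e = (THE d. \<exists>a b. e = {a, b} \<and> d = norm (a - b))"

lemma edge_length_pair: "edge_length {a, b} = norm (a - b)"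
  unfolding edge_length_def
  by (rule the_equality) (auto simp: doubleton_eq_iff norm_minus_commute)

definition matching_sum :: "nat \<Rightarrow> 'a::real_normed_vector set set \<Rightarrow> real" where
  "matching_sum k M = (\<Sum>e\<in>M. edge_length e ^ k)"

definition unit_cube :: "(real ^ 'n) set" where
  "unit_cube = {x. \<forall>i. 0 \<le> x $ i \<and> x $ i \<le> 1}"

definition min_matching_sum :: "nat \<Rightarrow> 'a::real_normed_vector set \<Rightarrow> real" where
  "min_matching_sum k X = Min {matching_sum k M | M. perfect_matching X M}"

text \<open>The dimension \<open>k\<close> is the cardinality of the index type. The supremum is taken in the
  extended reals, so that an upper bound for it also asserts that it is finite.\<close>

definition sup_min_matching_sum :: "'n::finite itself \<Rightarrow> ereal" where
  "sup_min_matching_sum _ =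
     (SUP X \<in> {X :: (real ^ 'n) set. finite X \<and> X \<subseteq> unit_cube \<and> even (card X)}.
        ereal (min_matching_sum CARD('n) X))"

text \<open>For finite sets of even size, the set in the definition of \<open>min_matching_sum\<close> is finite and nonempty.\<close>

lemma finite_perfect_matchings:
  assumes "finite X"
  shows "finite {M. perfect_matching X M}"
proof (rule finite_subset)
  show "{M. perfect_matching X M} \<subseteq> Pow (Pow X)"
    by (auto simp: perfect_matching_def complete_graph_edges_def)
qed (use assms in simp)

lemma finite_matching_sums:
  assumes "finite X"
  shows "finite {matching_sum k M | M. perfect_matching X M}"
  using finite_perfect_matchings[OF assms] by simp

lemma perfect_matching_exists:
  assumes "finite X" "even (card X)"
  shows "\<exists>M. perfect_matching X M"
  using assms
proof (induction "card X" arbitrary: X rule: less_induct)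
  case less
  show ?case
  proof (cases "X = {}")
    case True
    then show ?thesis by (auto simp: perfect_matching_def)
  next
    case False
    then have "card X \<noteq> 0"
      using less.prems by simp
    then have "card X \<ge> 2"
      using less.prems(2) by presburger
    then obtain T where T: "T \<subseteq> X" "card T = 2"
      by (meson obtain_subset_with_card_n)
    then obtain a b where ab: "T = {a, b}" "a \<noteq> b"
      by (auto simp: card_2_iff)
    let ?Y = "X - T"
    have c: "card ?Y = card X - 2"
      using T less.prems by (simp add: card_Diff_subset finite_subset)
    then obtain M where M: "perfect_matching ?Y M"
      using less.hyps[of ?Y] less.prems \<open>card X \<ge> 2\<close> by auto
    have sub: "e \<subseteq> ?Y" if "e \<in> M" for e
      using M that by (auto simp: perfect_matching_def complete_graph_edges_def)
    have "\<exists>!e. e \<in> insert T M \<and> x \<in> e" if "x \<in> X" for x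
    proof (cases "x \<in> T")
      case True
      then show ?thesis using sub by blast
    next
      case False
      then have "\<exists>!e. e \<in> M \<and> x \<in> e"
        using M that by (auto simp: perfect_matching_def)
      then show ?thesis using False by blast
    qed
    moreover have "T \<in> complete_graph_edges X"
      using T(1) ab unfolding complete_graph_edges_def by blast
    moreover have "complete_graph_edges ?Y \<subseteq> complete_graph_edges X"
      unfolding complete_graph_edges_def by blast
    moreover have "M \<subseteq> complete_graph_edges ?Y"
      using M by (simp add: perfect_matching_def)
    ultimately have "perfect_matching X (insert T M)"
      unfolding perfect_matching_def by (meson insert_subsetI subset_trans)
    then show ?thesis ..
  qed
qed

end

theory Submission
  imports Defs
begin

text \<open>
  Take a perfect matching \<open>M\<close> that minimises the sum of the \<^emph>\<open>squares\<close> of the edge lengths, and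
  associate with an edge \<open>ab\<close> the open ball with diameter \<open>ab\<close>, which consists of the points \<open>p\<close>
  with \<open>(a - p) \<bullet> (b - p) < 0\<close>. If \<open>p\<close> lies in the balls of \<open>ab\<close> and \<open>cd\<close>, then adding the two
  inequalities that express that \<open>ab, cd\<close> can be replaced by neither \<open>ac, bd\<close> nor \<open>ad, bc\<close> shows
  that the vectors \<open>a + b - 2p\<close> and \<open>c + d - 2p\<close> form an obtuse angle. Hence \<open>p\<close> lies in at most
  \<open>k + 1\<close> balls. If all points lie in a ball \<open>B\<close>, then so does the half of each of these balls that
  faces the centre of \<open>B\<close>. Comparing volumes, with \<open>B\<close> the circumscribed ball of the cube, gives
  the bound.
\<close>

section \<open>Exchanging two edges of a perfect matching\<close>

lemma perfect_matching_edgeE: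
  assumes "perfect_matching X M" "e \<in> M"
  obtains a b where "e = {a, b}" "a \<in> X" "b \<in> X" "a \<noteq> b"
  using assms unfolding perfect_matching_def complete_graph_edges_def by blast

lemma perfect_matching_edges_eq:
  assumes "perfect_matching X M" "e \<in> M" "f \<in> M" "x \<in> e" "x \<in> f"
  shows "e = f"
proof -
  have "x \<in> X"
    using assms by (auto elim: perfect_matching_edgeE)
  then show ?thesis
    using assms unfolding perfect_matching_def by blast
qed

lemma perfect_matching_finite:
  assumes "perfect_matching X M" "finite X"
  shows "finite M"
proof (rule finite_subset)
  show "M \<subseteq> Pow X"
    using assms(1) by (auto elim: perfect_matching_edgeE)
qed (use assms(2) in simp)

text \<open>Two distinct edges of a matching share no vertex, so re-pairing their four endpoints
  leaves all other edges intact. The last three conclusions ensure that the exchange adds exactly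
  two new terms to a sum over edges.\<close>

lemma perfect_matching_swap:
  assumes M: "perfect_matching X M"
    and ab: "{a, b} \<in> M" and cd: "{c, d} \<in> M" and ne: "{a, b} \<noteq> {c, d}"
  shows "perfect_matching X (M - {{a, b}, {c, d}} \<union> {{a, c}, {b, d}})" (is "perfect_matching X ?N")
    and "{a, c} \<notin> M" "{b, d} \<notin> M" "{a, c} \<noteq> {b, d}"
proof -
  note uniq = perfect_matching_edges_eq[OF M]
  have inX: "a \<in> X" "b \<in> X" "a \<noteq> b" "c \<in> X" "d \<in> X" "c \<noteq> d"
    by (rule perfect_matching_edgeE[OF M ab], force simp: doubleton_eq_iff)+
      (rule perfect_matching_edgeE[OF M cd], force simp: doubleton_eq_iff)+
  note abne = inX(3,6)
  have disj: "a \<noteq> c" "a \<noteq> d" "b \<noteq> c" "b \<noteq> d"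
    using uniq[OF ab cd] ne by auto
  show ac: "{a, c} \<notin> M"
    using uniq[OF ab, of "{a, c}" a] abne disj by (auto simp: doubleton_eq_iff)
  show bd: "{b, d} \<notin> M"
    using uniq[OF ab, of "{b, d}" b] abne disj by (auto simp: doubleton_eq_iff)
  show "{a, c} \<noteq> {b, d}"
    using abne disj by (auto simp: doubleton_eq_iff)
  have "?N \<subseteq> complete_graph_edges X"
  proof -
    have "{a, c} \<in> complete_graph_edges X" "{b, d} \<in> complete_graph_edges X"
      unfolding complete_graph_edges_def
      by (intro CollectI exI conjI, rule refl, use inX disj in simp_all)+
    moreover have "M \<subseteq> complete_graph_edges X"
      using M by (simp add: perfect_matching_def)
    ultimately show ?thesis
      by auto
  qed
  moreover have "\<exists>!e. e \<in> ?N \<and> x \<in> e" if "x \<in> X" for x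
  proof (cases "x \<in> {a, b, c, d}")
    case True
    have old: "x \<notin> e" if e: "e \<in> M - {{a, b}, {c, d}}" for e
    proof
      assume "x \<in> e"
      from True consider "x \<in> {a, b}" | "x \<in> {c, d}" by blast
      then show False
        using uniq[OF ab _ _ \<open>x \<in> e\<close>] uniq[OF cd _ _ \<open>x \<in> e\<close>] e by cases blast+
    qed
    show ?thesis
    proof (cases "x \<in> {a, c}")
      case True
      show ?thesis
        by (rule ex1I[of _ "{a, c}"]) (use True old abne disj in blast)+
    next
      case False
      show ?thesis
        by (rule ex1I[of _ "{b, d}"]) (use False \<open>x \<in> {a, b, c, d}\<close> old abne disj in blast)+
    qed
  next
    case False
    obtain e where "e \<in> M" "x \<in> e"
      using M \<open>x \<in> X\<close> unfolding perfect_matching_def by blast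
    then show ?thesis
      by (intro ex1I[of _ e]) (use False uniq[of e _ x] in blast)+
  qed
  ultimately show "perfect_matching X ?N"
    unfolding perfect_matching_def by (intro conjI ballI)
qed

text \<open>The edges in \<open>M'\<close> contribute equally to both sums and cancel. The exchange
  for \<open>{a, d}\<close> and \<open>{b, c}\<close> is the instance with \<open>c\<close> and
  \<open>d\<close> interchanged.\<close>

lemma minimal_matching_swap_le:
  fixes X :: "'a::real_normed_vector set"
  assumes "finite X" and M: "perfect_matching X M"
    and min: "\<And>N. perfect_matching X N \<Longrightarrow> matching_sum k M \<le> matching_sum k N"
    and ab: "{a, b} \<in> M" and cd: "{c, d} \<in> M" and ne: "{a, b} \<noteq> {c, d}"
  shows "norm (a - b) ^ k + norm (c - d) ^ k \<le> norm (a - c) ^ k + norm (b - d) ^ k"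
proof -
  define M' where "M' = M - {{a, b}, {c, d}}"
  note swap = perfect_matching_swap[OF M ab cd ne]
  have fin: "finite M'"
    using perfect_matching_finite[OF M \<open>finite X\<close>] by (simp add: M'_def)
  have M_eq: "M = insert {a, b} (insert {c, d} M')" and "{a, b} \<notin> M'" "{c, d} \<notin> M'"
    using ab cd by (auto simp: M'_def)
  then have "matching_sum k M = norm (a - b) ^ k + (norm (c - d) ^ k + matching_sum k M')"
    using fin ne by (subst M_eq) (simp add: matching_sum_def edge_length_pair)
  moreover have "matching_sum k (M' \<union> {{a, c}, {b, d}})
      = norm (a - c) ^ k + (norm (b - d) ^ k + matching_sum k M')"
  proof -
    have "{a, c} \<notin> M'" "{b, d} \<notin> M'"
      using swap(2,3) by (auto simp: M'_def)
    then show ?thesis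
      using fin swap(4) by (simp add: matching_sum_def edge_length_pair)
  qed
  moreover have "matching_sum k M \<le> matching_sum k (M' \<union> {{a, c}, {b, d}})"
    using swap(1) by (intro min) (simp add: M'_def)
  ultimately show ?thesis by linarith
qed

section \<open>Vectors at pairwise obtuse angles\<close>

text \<open>Without one vector \<open>v i0\<close> the family is linearly independent. Otherwise,
  separating a dependency by the signs of its coefficients makes a nonempty positive combination
  vanish, although it has a negative inner product with \<open>v i0\<close>.\<close>

lemma card_le_if_pairwise_obtuse:
  fixes v :: "'i \<Rightarrow> 'a::euclidean_space"
  assumes "finite I" and obtuse: "\<And>i j. i \<in> I \<Longrightarrow> j \<in> I \<Longrightarrow> i \<noteq> j \<Longrightarrow> v i \<bullet> v j < 0"
  shows "card I \<le> DIM('a) + 1"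
proof (cases "I = {}")
  case False
  then obtain i0 where i0: "i0 \<in> I" by blast
  \<comment> \<open>If \<open>v i = v j\<close> for distinct indices, then
    \<open>v i \<bullet> v j\<close> would be a square norm. Hence passing from indices to the set
    \<open>S\<close> loses no vectors.\<close>
  have inj: "inj_on v I"
    using obtuse by (metis inj_onI inner_ge_zero not_le)
  define S where "S = v ` (I - {i0})"
  have finS: "finite S" using \<open>finite I\<close> by (simp add: S_def)
  have S_obtuse: "x \<bullet> y < 0" if "x \<in> S" "y \<in> S" "x \<noteq> y" for x y
    using that obtuse by (auto simp: S_def)
  have S_i0: "x \<bullet> v i0 < 0" if "x \<in> S" for x
    using that obtuse i0 by (auto simp: S_def)
  have "independent S"
  proof
    assume "dependent S"
    then obtain u where u: "\<exists>x\<in>S. u x \<noteq> 0" "(\<Sum>x\<in>S. u x *\<^sub>R x) = 0"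
      using finS by (auto simp: real_vector.dependent_finite)
    define P where "P = {x\<in>S. u x > 0}"
    define N where "N = {x\<in>S. u x < 0}"
    define w where "w = (\<Sum>x\<in>P. u x *\<^sub>R x)"
    have fin: "finite P" "finite N" using finS by (auto simp: P_def N_def)
    have "(\<Sum>x\<in>S. u x *\<^sub>R x) = (\<Sum>x\<in>P \<union> N. u x *\<^sub>R x)"
      by (rule sum.mono_neutral_right) (use finS in \<open>auto simp: P_def N_def\<close>)
    also have "\<dots> = w + (\<Sum>x\<in>N. u x *\<^sub>R x)"
      unfolding w_def by (rule sum.union_disjoint) (use fin in \<open>auto simp: P_def N_def\<close>)
    finally have wN: "w = (\<Sum>x\<in>N. (- u x) *\<^sub>R x)"
      using u(2) by (simp add: sum_negf eq_neg_iff_add_eq_0)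
    \<comment> \<open>One factor is expanded over \<open>P\<close>, the other over \<open>N\<close>.
      These sets are disjoint, so only inner products of distinct vectors occur, all
      negative.\<close>
    have "w \<bullet> w = (\<Sum>x\<in>P. u x *\<^sub>R x) \<bullet> (\<Sum>x\<in>N. (- u x) *\<^sub>R x)"
      by (subst (2) wN) (simp only: w_def)
    also have "\<dots> = (\<Sum>x\<in>P. \<Sum>y\<in>N. u x * (- u y) * (x \<bullet> y))"
      unfolding inner_sum_left unfolding inner_sum_right by (simp add: mult_ac)
    also have "\<dots> \<le> 0"
    proof (intro sum_nonpos)
      fix x y assume "x \<in> P" "y \<in> N"
      then have "x \<bullet> y < 0" "0 < u x" "0 < - u y"
        by (auto simp: P_def N_def intro!: S_obtuse)
      then show "u x * (- u y) * (x \<bullet> y) \<le> 0"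
        by (intro mult_nonneg_nonpos mult_nonneg_nonneg) linarith+
    qed
    finally have "w = 0" using inner_ge_zero[of w] by (simp add: inner_eq_zero_iff)
    have pos: "(\<Sum>x\<in>T. c x *\<^sub>R x) \<bullet> v i0 < 0" if "T \<subseteq> S" "T \<noteq> {}" "\<And>x. x \<in> T \<Longrightarrow> c x > 0" for T c
    proof -
      have "finite T" using that(1) finS finite_subset by blast
      then have "(\<Sum>x\<in>T. c x * (x \<bullet> v i0)) < (\<Sum>x\<in>T. 0)"
        using that S_i0 by (intro sum_strict_mono) (auto simp: mult_pos_neg)
      then show ?thesis by (simp add: inner_sum_left)
    qed
    have "P \<noteq> {} \<or> N \<noteq> {}"
    proof -
      obtain x where "x \<in> S" "u x \<noteq> 0" using u(1) by blast
      then have "x \<in> P \<or> x \<in> N" by (auto simp: P_def N_def)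
      then show ?thesis by blast
    qed
    moreover have "P = {}"
    proof (rule ccontr)
      assume "P \<noteq> {}"
      then have "w \<bullet> v i0 < 0"
        unfolding w_def by (intro pos) (auto simp: P_def)
      then show False using \<open>w = 0\<close> by simp
    qed
    moreover have "N = {}"
    proof (rule ccontr)
      assume "N \<noteq> {}"
      then have "w \<bullet> v i0 < 0"
        unfolding wN by (intro pos) (auto simp: N_def)
      then show False using \<open>w = 0\<close> by simp
    qed
    ultimately show False by blast
  qed
  then have "card S \<le> DIM('a)" using independent_bound by blast
  moreover have "card S = card I - 1"
    unfolding S_def using inj i0 by (simp add: card_image inj_on_diff)
  ultimately show ?thesis by linarith
qed simp

section \<open>Half balls over the edges\<close>

text \<open>The second inequality cuts the ball by the hyperplane through its centre orthogonal to
  the line to \<open>z\<close>, keeping the side of \<open>z\<close>. Both inequalities are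
  symmetric in \<open>a\<close> and \<open>b\<close>, so the unordered edge needs no chosen
  orientation.\<close>

definition thales_half_ball :: "'a::real_inner \<Rightarrow> 'a set \<Rightarrow> 'a set" where
  "thales_half_ball z e = {p. \<exists>a b. e = {a, b} \<and> (a - p) \<bullet> (b - p) < 0
     \<and> (p - midpoint a b) \<bullet> (midpoint a b - z) \<le> 0}"

text \<open>In terms of \<open>m\<close> and \<open>w\<close>, identities about midpoints and radii
  become plain expansions of inner products; for instance, \<open>thales_identity\<close> is a
  difference of squares.\<close>

lemma midpoint_decomposition:
  fixes a b :: "'a::real_inner"
  obtains m w where "midpoint a b = m" "a = m + w" "b = m - w" "dist a b / 2 = norm w"
proof
  let ?m = "midpoint a b" and ?w = "a - midpoint a b"
  show "a = ?m + ?w" by simp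
  have "a + b = ?m + ?m" using midpoint_eq_iff by blast
  then have "b = ?m + ?m - a" by (metis add_diff_cancel_left')
  then show "b = ?m - ?w" by (simp only: diff_diff_eq2)
  show "dist a b / 2 = norm ?w" using dist_midpoint(1)[of a b] by (simp add: dist_norm)
qed simp

lemma thales_identity:
  fixes a b p :: "'a::real_inner"
  shows "(a - p) \<bullet> (b - p) = (dist (midpoint a b) p)\<^sup>2 - (dist a b / 2)\<^sup>2"
proof -
  obtain m w where mw: "midpoint a b = m" "a = m + w" "b = m - w" "dist a b / 2 = norm w"
    by (rule midpoint_decomposition)
  show ?thesis
    unfolding mw(1,4) unfolding mw(2,3)
    by (simp add: dist_norm power2_norm_eq_inner inner_simps inner_commute)
qed

lemma thales_half_ball_pair:
  fixes a b z :: "'a::real_inner"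
  shows "thales_half_ball z {a, b} = ball (midpoint a b) (dist a b / 2)
     \<inter> {p. (p - midpoint a b) \<bullet> (midpoint a b - z) \<le> 0}"
proof -
  have "(a - p) \<bullet> (b - p) < 0 \<longleftrightarrow> p \<in> ball (midpoint a b) (dist a b / 2)" for p
    unfolding thales_identity mem_ball
    using power_mono_iff[of "dist a b / 2" "dist (midpoint a b) p" 2] by (simp add: not_le[symmetric])
  moreover have "p \<in> thales_half_ball z {a, b} \<longleftrightarrow>
      (a - p) \<bullet> (b - p) < 0 \<and> (p - midpoint a b) \<bullet> (midpoint a b - z) \<le> 0" for p
    unfolding thales_half_ball_def mem_Collect_eq doubleton_eq_iff
    by (metis inner_commute midpoint_sym)
  ultimately show ?thesis
    by blast
qed

text \<open>Expanding the squared distance from \<open>z\<close> to \<open>p\<close> around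
  \<open>m\<close> leaves the cross term \<open>2 * t\<close>, which is nonpositive on the half
  facing \<open>z\<close>. The rest is at most the squared distance from \<open>z\<close> to
  \<open>m\<close> plus \<open>r^2\<close>, which is bounded by the median formula. The full ball
  may stick out of \<open>cball z R\<close>.\<close>

lemma thales_half_ball_subset:
  fixes a b z :: "'a::real_inner"
  assumes "a \<in> cball z R" "b \<in> cball z R"
  shows "thales_half_ball z {a, b} \<subseteq> cball z R"
proof
  fix p assume p: "p \<in> thales_half_ball z {a, b}"
  define m where "m = midpoint a b"
  define r where "r = dist a b / 2"
  define t where "t = (p - m) \<bullet> (m - z)"
  have "0 \<le> R" using assms(1) by (metis mem_cball zero_le_dist order_trans)
  have "dist m p < r" and half: "t \<le> 0"
    using p unfolding thales_half_ball_pair m_def r_def t_def by auto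
  then have "(dist m p)\<^sup>2 \<le> r\<^sup>2"
    by (intro power_mono) auto
  moreover have "(dist z p)\<^sup>2 = (dist m p)\<^sup>2 + 2 * t + (dist z m)\<^sup>2"
    by (simp add: t_def dist_norm power2_norm_eq_inner inner_simps inner_commute algebra_simps)
  moreover have "(dist z m)\<^sup>2 + r\<^sup>2 = ((dist z a)\<^sup>2 + (dist z b)\<^sup>2) / 2"
  proof -
    obtain m' w where mw: "midpoint a b = m'" "a = m' + w" "b = m' - w" "dist a b / 2 = norm w"
      by (rule midpoint_decomposition)
    show ?thesis
      unfolding m_def r_def mw(1,4) unfolding mw(2,3)
      by (simp add: dist_norm power2_norm_eq_inner inner_simps inner_commute)
  qed
  moreover have "(dist z a)\<^sup>2 \<le> R\<^sup>2" "(dist z b)\<^sup>2 \<le> R\<^sup>2"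
    using assms by (auto intro!: power_mono)
  then have "((dist z a)\<^sup>2 + (dist z b)\<^sup>2) / 2 \<le> R\<^sup>2"
    by simp
  ultimately have "(dist z p)\<^sup>2 \<le> R\<^sup>2" using half by (smt (verit))
  then show "p \<in> cball z R" using \<open>0 \<le> R\<close> by (simp add: abs_le_square_iff[symmetric])
qed

lemma thales_half_ball_lmeasurable:
  fixes a b z :: "'a::euclidean_space"
  shows "thales_half_ball z {a, b} \<in> lmeasurable"
  unfolding thales_half_ball_pair
proof (rule fmeasurable_Int_fmeasurable)
  have "closed {p. (p - midpoint a b) \<bullet> (midpoint a b - z) \<le> 0}"
    by (intro closed_Collect_le continuous_intros)
  then show "{p. (p - midpoint a b) \<bullet> (midpoint a b - z) \<le> 0} \<in> sets lebesgue"
    by (metis borel_closed sets_completionI_sets sets_lborel)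
qed simp

text \<open>The half ball \<open>H\<close> and its reflection \<open>H'\<close> in the midpoint have
  equal volume and together cover the ball.\<close>

lemma measure_thales_half_ball_ge:
  fixes a b z :: "'a::euclidean_space"
  shows "unit_ball_vol (DIM('a)) * (dist a b / 2) ^ DIM('a)
    \<le> 2 * measure lebesgue (thales_half_ball z {a, b})"
proof -
  define m where "m = midpoint a b"
  define H where "H = thales_half_ball z {a, b}"
  define H' where "H' = (\<lambda>p. (-1) *\<^sub>R p + 2 *\<^sub>R m) ` H"
  have H: "H \<in> lmeasurable"
    unfolding H_def by (rule thales_half_ball_lmeasurable)
  have "emeasure lebesgue H' = emeasure lebesgue H"
    unfolding H'_def using emeasure_lebesgue_affine[of "-1" "2 *\<^sub>R m" H] by simp
  moreover have "H' \<in> sets lebesgue"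
  proof -
    have "(*\<^sub>R) (-1) -` H \<inter> space lebesgue \<in> sets lebesgue"
      using H by (intro measurable_sets[OF lebesgue_measurable_scaling]) auto
    \<comment> \<open>Negation is its own inverse, so the image is a preimage and measurability of
      the scaling map applies.\<close>
    moreover have "(*\<^sub>R) (-1) -` H = (*\<^sub>R) (-1) ` H"
      by (auto simp: image_iff) (metis minus_minus)
    ultimately have "(+) (2 *\<^sub>R m) ` (*\<^sub>R) (-1) ` H \<in> sets lebesgue"
      by (intro lebesgue_sets_translation) simp
    then show ?thesis
      by (simp add: H'_def image_image add.commute)
  qed
  ultimately have H': "H' \<in> lmeasurable" "measure lebesgue H' = measure lebesgue H"
    using H by (auto simp: fmeasurable_def measure_def)
  have "ball m (dist a b / 2) \<subseteq> H \<union> H'"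
  proof
    fix p assume p: "p \<in> ball m (dist a b / 2)"
    show "p \<in> H \<union> H'"
    proof (cases "(p - m) \<bullet> (m - z) \<le> 0")
      case True
      then show ?thesis using p by (simp add: H_def thales_half_ball_pair m_def)
    next
      case False
      define q where "q = 2 *\<^sub>R m - p"
      have q: "q - m = - (p - m)" by (simp add: q_def scaleR_2)
      have "dist m q = dist m p"
        using q by (metis dist_commute dist_norm norm_minus_cancel)
      moreover have "(q - m) \<bullet> (m - z) \<le> 0"
        using False unfolding q inner_minus_left by simp
      ultimately have "q \<in> H" using p by (simp add: H_def thales_half_ball_pair m_def)
      moreover have "p = (-1) *\<^sub>R q + 2 *\<^sub>R m" by (simp add: q_def)
      ultimately show ?thesis unfolding H'_def by blast
    qed
  qed
  then have "measure lebesgue (ball m (dist a b / 2)) \<le> measure lebesgue (H \<union> H')"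
    using H H' by (intro measure_mono_fmeasurable) auto
  also have "\<dots> \<le> measure lebesgue H + measure lebesgue H'"
    using H H' by (intro measure_Un_le) auto
  finally show ?thesis
    using H' by (simp add: content_ball H_def)
qed

section \<open>Bounded overlap and comparison of volumes\<close>

lemma thales_half_balls_overlap:
  fixes X :: "'a::euclidean_space set"
  assumes "finite X" and M: "perfect_matching X M"
    and min: "\<And>N. perfect_matching X N \<Longrightarrow> matching_sum 2 M \<le> matching_sum 2 N"
  shows "card {e\<in>M. p \<in> thales_half_ball z e} \<le> DIM('a) + 1"
proof (rule card_le_if_pairwise_obtuse[where v = "\<lambda>e. \<Sum>x\<in>e. x - p"])
  show "finite {e \<in> M. p \<in> thales_half_ball z e}"
    using perfect_matching_finite[OF M \<open>finite X\<close>] by simp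
next
  fix e f
  assume e: "e \<in> {e \<in> M. p \<in> thales_half_ball z e}"
    and f: "f \<in> {e \<in> M. p \<in> thales_half_ball z e}" and "e \<noteq> f"
  obtain a b where ab: "e = {a, b}" "(a - p) \<bullet> (b - p) < 0"
    using e unfolding thales_half_ball_def by blast
  obtain c d where cd: "f = {c, d}" "(c - p) \<bullet> (d - p) < 0"
    using f unfolding thales_half_ball_def by blast
  \<comment> \<open>Distinct endpoints guarantee that the sum of \<open>x - p\<close> over the set
    \<open>{a, b}\<close> has two terms and equals \<open>a + b - 2p\<close>.\<close>
  have ne: "a \<noteq> b" "c \<noteq> d"
    using ab(2) cd(2) by (metis inner_ge_zero not_le)+
  have "norm (a - b) ^ 2 + norm (c - d) ^ 2 \<le> norm (a - c) ^ 2 + norm (b - d) ^ 2"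
    using e f \<open>e \<noteq> f\<close> ab cd by (intro minimal_matching_swap_le[OF \<open>finite X\<close> M min]) auto
  moreover have "norm (a - b) ^ 2 + norm (c - d) ^ 2 \<le> norm (a - d) ^ 2 + norm (b - c) ^ 2"
    using minimal_matching_swap_le[OF \<open>finite X\<close> M min, of a b d c] e f \<open>e \<noteq> f\<close> ab cd
    by (simp add: insert_commute norm_minus_commute)
  \<comment> \<open>With \<open>p\<close> as origin, each of the four points contributes its squared
    norm twice to either side of the added inequalities. These terms cancel and only mixed products
    remain; this is why exponent 2 is minimised.\<close>
  ultimately have "((a - p) + (b - p)) \<bullet> ((c - p) + (d - p))
      \<le> 2 * ((a - p) \<bullet> (b - p)) + 2 * ((c - p) \<bullet> (d - p))"
    by (simp add: power2_norm_eq_inner inner_simps inner_commute algebra_simps)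
  also have "\<dots> < 0" using ab cd by simp
  finally show "(\<Sum>x\<in>e. x - p) \<bullet> (\<Sum>x\<in>f. x - p) < 0"
    using ab cd ne by simp
qed

text \<open>In the bound, the factor 2 comes from using half balls, \<open>DIM('a) + 1\<close> from
  the overlap, and \<open>2 * R\<close> from the radius of each ball being half its edge.\<close>

lemma matching_sum_cball_bound:
  fixes X :: "'a::euclidean_space set"
  assumes "finite X" "X \<subseteq> cball z R" "even (card X)" "0 \<le> R"
  shows "\<exists>M. perfect_matching X M \<and>
    matching_sum DIM('a) M \<le> 2 * (real DIM('a) + 1) * (2 * R) ^ DIM('a)"
proof -
  define n where "n = DIM('a)"
  \<comment> \<open>The minimiser is taken for exponent 2 in every dimension; the exponent
    \<open>n\<close> enters only through volumes.\<close>
  define M where "M = arg_min_on (matching_sum 2) {M. perfect_matching X M}"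
  have fin: "finite {M. perfect_matching X M}" and ne: "{M. perfect_matching X M} \<noteq> {}"
    using finite_perfect_matchings perfect_matching_exists assms by auto
  have M: "perfect_matching X M"
    using arg_min_if_finite(1)[OF fin ne] by (simp add: M_def)
  have min: "matching_sum 2 M \<le> matching_sum 2 N" if "perfect_matching X N" for N
    using arg_min_least[OF fin ne] that by (simp add: M_def)
  have finM: "finite M"
    using perfect_matching_finite[OF M assms(1)] .
  let ?H = "thales_half_ball z" and ?\<mu> = "measure lebesgue"
  have meas: "?H e \<in> lmeasurable" if "e \<in> M" for e
    using perfect_matching_edgeE[OF M that] thales_half_ball_lmeasurable by metis
  have sub: "?H e \<subseteq> cball z R" if "e \<in> M" for e
    using perfect_matching_edgeE[OF M that] thales_half_ball_subset assms(2) by (metis subsetD)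
  have len: "unit_ball_vol n * (edge_length e / 2) ^ n \<le> 2 * ?\<mu> (?H e)" if e: "e \<in> M" for e
  proof -
    obtain a b where "e = {a, b}" using perfect_matching_edgeE[OF M e] by blast
    then show ?thesis
      using measure_thales_half_ball_ge[of a b z] by (simp add: n_def edge_length_pair dist_norm)
  qed
  \<comment> \<open>Double counting: the total volume is the integral of the number of half balls
    containing \<open>p\<close>, which is at most \<open>n + 1\<close> and vanishes outside
    \<open>cball z R\<close>.\<close>
  have "(\<Sum>e\<in>M. ?\<mu> (?H e)) = (\<Sum>e\<in>M. \<integral>p. indicator (?H e) p \<partial>lebesgue)"
    by simp
  also have "\<dots> = (\<integral>p. (\<Sum>e\<in>M. indicator (?H e) p) \<partial>lebesgue)"
    using meas by (intro Bochner_Integration.integral_sum[symmetric]) (auto simp: lmeasurable_iff_integrable)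
  also have "\<dots> \<le> (\<integral>p. (real n + 1) * indicator (cball z R) p \<partial>lebesgue)"
  proof (rule integral_mono)
    fix p
    have "(\<Sum>e\<in>M. indicator (?H e) p) = real (card {e\<in>M. p \<in> ?H e})"
      using finM by (simp add: indicator_def sum.If_cases Int_def)
    also have "\<dots> \<le> (real n + 1) * indicator (cball z R) p"
    proof (cases "p \<in> cball z R")
      case True
      then show ?thesis
        using thales_half_balls_overlap[OF assms(1) M min, of p z] by (simp add: n_def)
    next
      case False
      then have "{e\<in>M. p \<in> ?H e} = {}" using sub by blast
      then show ?thesis by (simp only: card.empty) simp
    qed
    finally show "(\<Sum>e\<in>M. indicator (?H e) p) \<le> (real n + 1) * indicator (cball z R) p" .
  next
    show "integrable lebesgue (\<lambda>p. \<Sum>e\<in>M. indicator (?H e) p :: real)"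
      using meas by (intro Bochner_Integration.integrable_sum) (auto simp: lmeasurable_iff_integrable)
  next
    have "cball z R \<in> lmeasurable" by simp
    then show "integrable lebesgue (\<lambda>p. (real n + 1) * indicator (cball z R) p :: real)"
      by (intro integrable_mult_right) (auto simp: lmeasurable_iff_integrable)
  qed
  also have "\<dots> = (real n + 1) * (unit_ball_vol n * R ^ n)"
    using assms(4) by (simp add: content_cball n_def)
  finally have "(\<Sum>e\<in>M. ?\<mu> (?H e)) \<le> (real n + 1) * (unit_ball_vol n * R ^ n)" .
  moreover have "unit_ball_vol n * (matching_sum n M / 2 ^ n) \<le> 2 * (\<Sum>e\<in>M. ?\<mu> (?H e))"
    using sum_mono[of M, OF len]
    by (simp add: matching_sum_def sum_distrib_left sum_divide_distrib power_divide)
  ultimately have "unit_ball_vol n * (matching_sum n M / 2 ^ n)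
      \<le> unit_ball_vol n * (2 * (real n + 1) * R ^ n)"
    by (simp add: algebra_simps)
  then have "matching_sum n M / 2 ^ n \<le> 2 * (real n + 1) * R ^ n"
    by (rule mult_left_le_imp_le) simp
  then have "matching_sum n M \<le> 2 * (real n + 1) * (2 * R) ^ n"
    by (simp add: field_simps power_mult_distrib)
  then show ?thesis
    using M unfolding n_def by blast
qed

section \<open>The unit cube and its circumscribed ball\<close>

lemma unit_cube_subset_cball:
  "(unit_cube :: (real ^ 'n) set) \<subseteq> cball (\<chi> i. 1 / 2) (sqrt (real CARD('n)) / 2)"
proof
  fix x :: "real ^ 'n" assume x: "x \<in> unit_cube"
  let ?c = "\<chi> i. 1 / 2 :: real ^ 'n"
  have "(dist ?c x)\<^sup>2 = (\<Sum>i\<in>UNIV. (1 / 2 - x $ i)\<^sup>2)"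
    by (simp add: dist_vec_def L2_set_def sum_nonneg dist_real_def)
  also have "\<dots> \<le> (\<Sum>i\<in>(UNIV :: 'n set). (1 / 2)\<^sup>2)"
  proof (rule sum_mono)
    fix i
    have "\<bar>1 / 2 - x $ i\<bar> \<le> 1 / 2"
      using x[unfolded unit_cube_def, simplified, rule_format, of i] by linarith
    then show "(1 / 2 - x $ i)\<^sup>2 \<le> (1 / 2)\<^sup>2"
      by (metis abs_ge_zero power2_abs power_mono)
  qed
  also have "\<dots> = (sqrt (real CARD('n)) / 2)\<^sup>2"
    by (simp add: power_divide)
  finally show "x \<in> cball ?c (sqrt (real CARD('n)) / 2)"
    unfolding mem_cball by (rule power2_le_imp_le) simp
qed

theorem theorem1p11:
  shows "(\<forall>X :: (real ^ 'n) set. finite X \<and> X \<subseteq> unit_cube \<and> even (card X) \<longrightarrow>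
            (\<exists>M. perfect_matching X M \<and>
                 matching_sum CARD('n) M
                   \<le> 2 * (real CARD('n) + 1) * real CARD('n) powr (real CARD('n) / 2)))
       \<and> sup_min_matching_sum TYPE('n)
           \<le> ereal (2 * (real CARD('n) + 1) * real CARD('n) powr (real CARD('n) / 2))"
    (is "?bound \<and> ?sup")
proof
  \<comment> \<open>The circumscribed ball has the diagonal of the cube, of length
    \<open>sqrt k\<close>, as its diameter \<open>2 * R\<close>.\<close>
  have powr: "(2 * (sqrt (real CARD('n)) / 2)) ^ CARD('n) = real CARD('n) powr (real CARD('n) / 2)"
    by (simp add: powr_half_sqrt[symmetric] powr_powr flip: powr_realpow')
  show bound: ?bound
  proof (intro allI impI)
    fix X :: "(real ^ 'n) set"
    assume X: "finite X \<and> X \<subseteq> unit_cube \<and> even (card X)"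
    then have "X \<subseteq> cball (\<chi> i. 1 / 2) (sqrt (real CARD('n)) / 2)"
      using unit_cube_subset_cball by blast
    then show "\<exists>M. perfect_matching X M \<and> matching_sum CARD('n) M
        \<le> 2 * (real CARD('n) + 1) * real CARD('n) powr (real CARD('n) / 2)"
      using matching_sum_cball_bound[of X "\<chi> i. 1 / 2" "sqrt (real CARD('n)) / 2"] X by (simp flip: powr)
  qed
  show ?sup
    unfolding sup_min_matching_sum_def
  proof (rule SUP_least, unfold ereal_less_eq)
    fix X :: "(real ^ 'n) set"
    assume "X \<in> {X. finite X \<and> X \<subseteq> unit_cube \<and> even (card X)}"
    then obtain M where "finite X" "perfect_matching X M" and
      le: "matching_sum CARD('n) M
        \<le> 2 * (real CARD('n) + 1) * real CARD('n) powr (real CARD('n) / 2)"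
      using bound by blast
    then have "min_matching_sum CARD('n) X \<le> matching_sum CARD('n) M"
      unfolding min_matching_sum_def by (intro Min_le finite_matching_sums) auto
    with le show "min_matching_sum CARD('n) X
        \<le> 2 * (real CARD('n) + 1) * real CARD('n) powr (real CARD('n) / 2)"
      by linarith
  qed
qed

end
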